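(* Let $K\ge 1$. Every contact $K$-quasiconformal transformation of $\mathfrak H^\star$ is also a contact $K$-quasiconformal transformation of an open and connected subset of the Heisenberg group $\mathfrak H$ (namely of $\mathbb C_*\times\mathbb R\subset\mathfrak H$).
   Context: The Heisenberg group $\mathfrak H$ is $\mathbb C\times\mathbb R$ with contact form $\omega=dt+2\Im(\overline z\,dz)$ and complex vector fields $Z=\frac{\partial}{\partial z}+i\overline z\frac{\partial}{\partial t}$, $\overline Z=\frac{\partial}{\partial\overline z}-iz\frac{\partial}{\partial t}$. The hyperbolic Heisenberg group $\mathfrak H^\star$ is $\mathbb C_*\times\mathbb R$, $\mathbb C_*=\mathbb C\setminus\{0\}$, with contact form $\omega^\star=\frac{\omega}{2|z|^2}$ and complex vector fields $\mathbf Z=zZ=z\frac{\partial}{\partial z}+i|z|^2\frac{\partial}{\partial t}$, $\overline{\mathbf Z}=\overline z\,\overline Z$. A contact $K$-quasiconformal transformation of $\mathfrak H^\star$ is an orientation-preserving diffeomorphism $F=(f_I,f_3)$ of $\mathfrak H^\star$ ($f_I$ complex-valued, $f_3$ real-valued), at least of class $\mathcal C^2$, such that $F^*\omega^\star=\lambda^\star\omega^\star$ for some positive function $\lambda^\star$ and $$\frac{|\mathbf Zf_I|+|\overline{\mathbf Z}f_I|}{|\mathbf Zf_I|-|\overline{\mathbf Z}f_I|}\le K\quad\text{on }\mathfrak H^\star.$$ A contact $K$-quasiconformal transformation of an open connected set $\Omega\subset\mathfrak H$ is an orientation-preserving diffeomorphism $F=(f_I,f_3)$ of $\Omega$, at least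 of class $\mathcal C^2$, such that $F^*\omega=\lambda\omega$ for some positive function $\lambda$ and $$\frac{|Zf_I|+|\overline Zf_I|}{|Zf_I|-|\overline Zf_I|}\le K\quad\text{on }\Omega.$$ *)

theory Defs
  imports "HOL-Analysis.Analysis"
begin

text \<open>Points \<open>(z, t)\<close> of the Heisenberg group are elements of \<open>complex \<times> real\<close>. Maps are total
  functions on this type; every condition below only concerns their values on an open set.\<close>

definition C2_on :: "'a::real_normed_vector set \<Rightarrow> ('a \<Rightarrow> 'b::real_normed_vector) \<Rightarrow> bool" where
  "C2_on S f \<longleftrightarrow>
     (\<exists>(f' :: 'a \<Rightarrow> ('a \<Rightarrow>\<^sub>L 'b)) (f'' :: 'a \<Rightarrow> ('a \<Rightarrow>\<^sub>L ('a \<Rightarrow>\<^sub>L 'b))).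
        (\<forall>x\<in>S. (f has_derivative blinfun_apply (f' x)) (at x)) \<and>
        (\<forall>x\<in>S. (f' has_derivative blinfun_apply (f'' x)) (at x)) \<and>
        continuous_on S f'')"

definition C2_diffeo_of :: "'a::real_normed_vector set \<Rightarrow> ('a \<Rightarrow> 'a) \<Rightarrow> bool" where
  "C2_diffeo_of S F \<longleftrightarrow> bij_betw F S S \<and> C2_on S F \<and> C2_on S (inv_into S F)"

definition to_R3 :: "complex \<times> real \<Rightarrow> real ^ 3" where
  "to_R3 p = vector [Re (fst p), Im (fst p), snd p]"

definition of_R3 :: "real ^ 3 \<Rightarrow> complex \<times> real" where
  "of_R3 v = (Complex (v $ 1) (v $ 2), v $ 3)"

definition jacobian :: "(complex \<times> real \<Rightarrow> complex \<times> real) \<Rightarrow> complex \<times> real \<Rightarrow> real" where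
  "jacobian F p = det (matrix (to_R3 \<circ> frechet_derivative F (at p) \<circ> of_R3))"

definition orientation_preserving_on ::
    "(complex \<times> real) set \<Rightarrow> (complex \<times> real \<Rightarrow> complex \<times> real) \<Rightarrow> bool" where
  "orientation_preserving_on S F \<longleftrightarrow> (\<forall>p\<in>S. 0 < jacobian F p)"

text \<open>A one-form maps a base point and a tangent vector to a real number.\<close>

type_synonym one_form = "complex \<times> real \<Rightarrow> complex \<times> real \<Rightarrow> real"

definition pullback :: "(complex \<times> real \<Rightarrow> complex \<times> real) \<Rightarrow> one_form \<Rightarrow> one_form" where
  "pullback F \<alpha> p v = \<alpha> (F p) (frechet_derivative F (at p) v)"

definition contact_on ::
    "one_form \<Rightarrow> (complex \<times> real) set \<Rightarrow> (complex \<times> real \<Rightarrow> complex \<times> real) \<Rightarrow> bool" where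
  "contact_on \<alpha> S F \<longleftrightarrow>
     (\<exists>l :: complex \<times> real \<Rightarrow> real. \<forall>p\<in>S. 0 < l p \<and> (\<forall>v. pullback F \<alpha> p v = l p * \<alpha> p v))"

text \<open>On the tangent vector \<open>v = (w, s)\<close> one has \<open>dz v = w\<close> and \<open>dt v = s\<close>.\<close>

definition omega :: one_form where
  "omega p v = snd v + 2 * Im (cnj (fst p) * fst v)"

definition omega_star :: one_form where
  "omega_star p v = omega p v / (2 * (cmod (fst p))\<^sup>2)"

definition Hstar :: "(complex \<times> real) set" where
  "Hstar = (UNIV - {0}) \<times> UNIV"

text \<open>With \<open>z = x + \<i> y\<close>, the derivatives with respect to \<open>x\<close>, \<open>y\<close> and \<open>t\<close> are the
  directional derivatives along \<open>(1, 0)\<close>, \<open>(\<i>, 0)\<close> and \<open>(0, 1)\<close>.\<close>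

definition d_z :: "(complex \<times> real \<Rightarrow> complex) \<Rightarrow> complex \<times> real \<Rightarrow> complex" where
  "d_z f p =
     (frechet_derivative f (at p) (1, 0) - \<i> * frechet_derivative f (at p) (\<i>, 0)) / 2"

definition d_zbar :: "(complex \<times> real \<Rightarrow> complex) \<Rightarrow> complex \<times> real \<Rightarrow> complex" where
  "d_zbar f p =
     (frechet_derivative f (at p) (1, 0) + \<i> * frechet_derivative f (at p) (\<i>, 0)) / 2"

definition d_t :: "(complex \<times> real \<Rightarrow> complex) \<Rightarrow> complex \<times> real \<Rightarrow> complex" where
  "d_t f p = frechet_derivative f (at p) (0, 1)"

definition Z :: "(complex \<times> real \<Rightarrow> complex) \<Rightarrow> complex \<times> real \<Rightarrow> complex" where
  "Z f p = d_z f p + \<i> * cnj (fst p) * d_t f p"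

definition Zbar :: "(complex \<times> real \<Rightarrow> complex) \<Rightarrow> complex \<times> real \<Rightarrow> complex" where
  "Zbar f p = d_zbar f p - \<i> * fst p * d_t f p"

definition Z_star :: "(complex \<times> real \<Rightarrow> complex) \<Rightarrow> complex \<times> real \<Rightarrow> complex" where
  "Z_star f p = fst p * Z f p"

definition Zbar_star :: "(complex \<times> real \<Rightarrow> complex) \<Rightarrow> complex \<times> real \<Rightarrow> complex" where
  "Zbar_star f p = cnj (fst p) * Zbar f p"

text \<open>In the two definitions below, the disequality says that the dilatation quotient is defined;
  without it the convention \<open>a / 0 = 0\<close> would let points with zero denominator pass the bound.\<close>

definition contact_qc_Hstar ::
    "real \<Rightarrow> (complex \<times> real \<Rightarrow> complex \<times> real) \<Rightarrow> bool" where
  "contact_qc_Hstar K F \<longleftrightarrow>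
     C2_diffeo_of Hstar F \<and> orientation_preserving_on Hstar F \<and> contact_on omega_star Hstar F \<and>
     (\<forall>p\<in>Hstar. let a = cmod (Z_star (fst \<circ> F) p); b = cmod (Zbar_star (fst \<circ> F) p)
        in a \<noteq> b \<and> (a + b) / (a - b) \<le> K)"

definition contact_qc_H ::
    "real \<Rightarrow> (complex \<times> real) set \<Rightarrow> (complex \<times> real \<Rightarrow> complex \<times> real) \<Rightarrow> bool" where
  "contact_qc_H K S F \<longleftrightarrow>
     C2_diffeo_of S F \<and> orientation_preserving_on S F \<and> contact_on omega S F \<and>
     (\<forall>p\<in>S. let a = cmod (Z (fst \<circ> F) p); b = cmod (Zbar (fst \<circ> F) p)
        in a \<noteq> b \<and> (a + b) / (a - b) \<le> K)"

end

theory Submission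
  imports Defs
begin

text \<open>Off the axis z = 0 the two structures differ only by nonvanishing factors. The form
  \<open>omega_star\<close> is a positive multiple of \<open>omega\<close>, so contact maps for one
  are contact maps for the other, with a rescaled positive factor
  (\<open>contact_on_omega_if_omega_star\<close>). The fields \<open>Z_star\<close> and
  \<open>Zbar_star\<close> are \<open>Z\<close> and \<open>Zbar\<close> times factors of the same
  modulus |z|, which cancels in the dilatation quotient, so K is unchanged. Smoothness and
  orientation are the same conditions in both settings.\<close>

lemma Hstar_iff: "p \<in> Hstar \<longleftrightarrow> fst p \<noteq> 0"
  by (cases p) (simp add: Hstar_def)

lemma open_Hstar: "open Hstar"
  unfolding Hstar_def by (intro open_Times open_Diff) auto

lemma connected_Hstar: "connected Hstar"
proof -
  have "connected (UNIV - {0::complex})"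
    \<comment> \<open>Removing a point keeps the space connected because the complex plane has real
      dimension 2.\<close>
    using connected_punctured_universe[of "0::complex"] by (simp add: Compl_eq_Diff_UNIV)
  then show ?thesis
    unfolding Hstar_def by (intro connected_Times connected_UNIV)
qed

lemma contact_on_omega_if_omega_star:
  assumes F: "F ` S \<subseteq> Hstar" and S: "S \<subseteq> Hstar" and contact: "contact_on omega_star S F"
  shows "contact_on omega S F"
proof -
  obtain l where l: "\<And>p. p \<in> S \<Longrightarrow> 0 < l p"
    "\<And>p v. p \<in> S \<Longrightarrow> pullback F omega_star p v = l p * omega_star p v"
    using contact unfolding contact_on_def by blast
  \<comment> \<open>Clearing 2|f_I|^2 on the pullback side and 2|z|^2 on the other turns the factor
    \<open>l\<close> into \<open>m\<close>; the 2s cancel.\<close>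
  define m where "m p = l p * (cmod (fst (F p)))\<^sup>2 / (cmod (fst p))\<^sup>2" for p
  have "0 < m p \<and> (\<forall>v. pullback F omega p v = m p * omega p v)" if p: "p \<in> S" for p
  proof -
    have nz: "fst p \<noteq> 0" "fst (F p) \<noteq> 0"
      using p F S by (auto simp: Hstar_iff)
    have "pullback F omega p v = m p * omega p v" for v
      using l(2)[OF p, of v] nz by (simp add: pullback_def omega_star_def m_def field_simps)
    then show ?thesis
      using l(1)[OF p] nz by (simp add: m_def)
  qed
  then show ?thesis
    unfolding contact_on_def by blast
qed

lemma cmod_Z_star: "cmod (Z_star f p) = cmod (fst p) * cmod (Z f p)"
  by (simp add: Z_star_def norm_mult)

lemma cmod_Zbar_star: "cmod (Zbar_star f p) = cmod (fst p) * cmod (Zbar f p)"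
  by (simp add: Zbar_star_def norm_mult)

theorem proposition5p6:
  fixes K :: real and F :: "complex \<times> real \<Rightarrow> complex \<times> real"
  assumes "1 \<le> K" and "contact_qc_Hstar K F"
  shows "open Hstar \<and> connected Hstar \<and> contact_qc_H K Hstar F"
proof -
  have diffeo: "C2_diffeo_of Hstar F" and orient: "orientation_preserving_on Hstar F"
    and contact: "contact_on omega_star Hstar F"
    and dil: "\<And>p. p \<in> Hstar \<Longrightarrow>
      cmod (Z_star (fst \<circ> F) p) \<noteq> cmod (Zbar_star (fst \<circ> F) p) \<and>
      (cmod (Z_star (fst \<circ> F) p) + cmod (Zbar_star (fst \<circ> F) p)) /
      (cmod (Z_star (fst \<circ> F) p) - cmod (Zbar_star (fst \<circ> F) p)) \<le> K"
    using assms(2) by (auto simp: contact_qc_Hstar_def Let_def)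
  \<comment> \<open>This makes f_I nonvanishing, so the new contact factor is positive.\<close>
  have "F ` Hstar \<subseteq> Hstar"
    using diffeo by (auto simp: C2_diffeo_of_def bij_betw_def)
  then have "contact_on omega Hstar F"
    using contact by (intro contact_on_omega_if_omega_star) auto
  moreover have "cmod (Z (fst \<circ> F) p) \<noteq> cmod (Zbar (fst \<circ> F) p) \<and>
      (cmod (Z (fst \<circ> F) p) + cmod (Zbar (fst \<circ> F) p)) /
      (cmod (Z (fst \<circ> F) p) - cmod (Zbar (fst \<circ> F) p)) \<le> K" if p: "p \<in> Hstar" for p
    \<comment> \<open>The flipped distributive laws pull out the common factor |z|, which is nonzero
      and cancels in both the disequality and the quotient.\<close>
    using dil[OF p] p
    by (simp add: Hstar_iff cmod_Z_star cmod_Zbar_star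
        split: if_splits flip: distrib_left right_diff_distrib)
  ultimately show ?thesis
    using diffeo orient open_Hstar connected_Hstar by (simp add: contact_qc_H_def Let_def)
qed

end
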